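(* Let $P$ be a finite pure poset of rank $r$. Then for any $f\in C_P$, $f$ belongs to $K_P$ if and only if the following conditions are satisfied: (1) for any $0\leq i\leq r-1$ and for any non-empty proper subset $X$ of any connected component of rank $i$, it holds that $f(X)<f(N_P(X))$; (2) for all $x\in P$, $f(x)>0$.
   Context: $\mathbb{N}_0=\{0,1,2,\dots\}$ and $\mathbb{K}$ is a field. The length of a chain $C$ in a finite poset is $|C|-1$. A finite poset $P$ is pure of rank $r$ if every maximal chain of $P$ has length $r$. For $x<y$ in $P$, $y$ covers $x$ if there is no $z$ with $x<z<y$. A pure poset has a unique rank function $\rho:P\to\mathbb{N}_0$ with $\rho(m)=0$ for minimal $m$ and $\rho(y)=\rho(x)+1$ whenever $y$ covers $x$. Set $P_i=\{a\in P: \rho(a)=i\}$ for $0\le i\le r$. For $S\subseteq P_i$ with $0\le i\le r-1$, $N_P(S)$ is the set of elements of $P_{i+1}$ that cover some element of $S$. For a function $f$ on $P$ and $A\subseteq P$, $f(A)=\sum_{x\in A}f(x)$. To each maximal chain $C: x_0<x_1<\cdots<x_r$ associate the monomial $x_C=x_0x_1\cdots x_r$ in the polynomial ring $\mathbb{K}[x : x\in P]$. The chain algebra $\mathbb{K}[C_P]$ is the $\mathbb{K}$-subalgebra generated by all $x_C$, with $C$ a maximal chain of $P$. The chain semigroup $C_P$ is the set of all functions $f:P\to\mathbb{N}_0$ such that $\prod_{x\in P}x^{f(x)}\in\mathbb{K}[C_P]$. $K_P$ is the set of all $f\in C_P$ such that for every $g\in C_P$ there exist an integer $n>0$ and $h\in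 C_P$ with $nf=g+h$. (The $\mathbb{K}$-span of the monomials $\prod_{x}x^{f(x)}$, $f\in K_P$, is an ideal of $\mathbb{K}[C_P]$ isomorphic to its canonical module.) For $0\le i\le r-1$, $G_i(P)$ is the bipartite graph with partition $(P_i,P_{i+1})$ in which $a\in P_i$ and $b\in P_{i+1}$ are adjacent iff $b$ covers $a$. Let $G_{i,1},\ldots,G_{i,k_i}$ be its connected components (as a graph) and $P_{i,j}=V(G_{i,j})\cap P_i$, so that $G_{i,j}$ has bipartition $(P_{i,j},N_P(P_{i,j}))$. The sets $P_{i,j}$, $j=1,\ldots,k_i$, are called the connected components of rank $i$. *)

theory Defs
  imports Complex_Main "HOL-Library.Poly_Mapping"
begin

text \<open>
  A finite poset is a finite set \<^term>\<open>P\<close> of elements of an ordered type, with the induced order.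
  A function on \<^term>\<open>P\<close> is encoded as a function on the whole type vanishing outside
  \<^term>\<open>P\<close>, so that equality of such encodings is equality on \<^term>\<open>P\<close>.
\<close>

definition maximal_chain :: "'a::order set \<Rightarrow> 'a set \<Rightarrow> bool" where
  "maximal_chain P C \<longleftrightarrow> pred_on.maxchain P (<) C"

text \<open>A chain \<^term>\<open>C\<close> has length \<open>|C| - 1\<close>. Written with \<open>r + 1\<close>, this
  excludes the empty poset, whose only chain has length \<open>-1\<close>.\<close>

definition pure_of_rank :: "'a::order set \<Rightarrow> nat \<Rightarrow> bool" where
  "pure_of_rank P r \<longleftrightarrow> (\<forall>C. maximal_chain P C \<longrightarrow> card C = r + 1)"

definition covers :: "'a::order set \<Rightarrow> 'a \<Rightarrow> 'a \<Rightarrow> bool" where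
  "covers P y x \<longleftrightarrow> x \<in> P \<and> y \<in> P \<and> x < y \<and> \<not> (\<exists>z\<in>P. x < z \<and> z < y)"

definition is_rank_function :: "'a::order set \<Rightarrow> ('a \<Rightarrow> nat) \<Rightarrow> bool" where
  "is_rank_function P \<rho> \<longleftrightarrow>
     (\<forall>x. x \<notin> P \<longrightarrow> \<rho> x = 0) \<and>
     (\<forall>m\<in>P. \<not> (\<exists>x\<in>P. x < m) \<longrightarrow> \<rho> m = 0) \<and>
     (\<forall>x y. covers P y x \<longrightarrow> \<rho> y = \<rho> x + 1)"

definition rank_fun :: "'a::order set \<Rightarrow> 'a \<Rightarrow> nat" where
  "rank_fun P = (THE \<rho>. is_rank_function P \<rho>)"

definition rank_level :: "'a::order set \<Rightarrow> nat \<Rightarrow> 'a set" where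
  "rank_level P i = {a \<in> P. rank_fun P a = i}"

text \<open>The set \<open>N\<^sub>P(S)\<close>, intended for \<open>S \<subseteq> P\<^sub>i\<close>.\<close>

definition cover_nbhd :: "'a::order set \<Rightarrow> nat \<Rightarrow> 'a set \<Rightarrow> 'a set" where
  "cover_nbhd P i S = {b \<in> rank_level P (i + 1). \<exists>a\<in>S. covers P b a}"

subsection \<open>Chain algebra and chain semigroup\<close>

text \<open>
  Polynomials over \<^typ>\<open>'k\<close> in variables indexed by \<^typ>\<open>'a\<close>. The chain algebra is generated by
  monomials in variables from \<^term>\<open>P\<close> only, so generating it in this larger ring instead of
  \<open>K[x : x \<in> P]\<close> makes no difference.
\<close>

type_synonym ('a, 'k) mpolynomial = "('a \<Rightarrow>\<^sub>0 nat) \<Rightarrow>\<^sub>0 'k"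

definition const_poly :: "'k::field \<Rightarrow> ('a, 'k) mpolynomial" where
  "const_poly c = Poly_Mapping.single 0 c"

definition var_poly :: "'a \<Rightarrow> ('a, 'k::field) mpolynomial" where
  "var_poly x = Poly_Mapping.single (Poly_Mapping.single x 1) 1"

definition is_subalgebra :: "('a, 'k::field) mpolynomial set \<Rightarrow> bool" where
  "is_subalgebra A \<longleftrightarrow>
     (\<forall>c. const_poly c \<in> A) \<and> (\<forall>p\<in>A. \<forall>q\<in>A. p + q \<in> A) \<and> (\<forall>p\<in>A. \<forall>q\<in>A. p * q \<in> A)"

definition chain_algebra :: "'a::order set \<Rightarrow> ('a, 'k::field) mpolynomial set" where
  "chain_algebra P = is_subalgebra hull {(\<Prod>x\<in>C. var_poly x) | C. maximal_chain P C}"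

definition chain_semigroup :: "'k::field itself \<Rightarrow> 'a::order set \<Rightarrow> ('a \<Rightarrow> nat) set" where
  "chain_semigroup K P =
     {f. (\<forall>x. x \<notin> P \<longrightarrow> f x = 0) \<and>
         (\<Prod>x\<in>P. var_poly x ^ f x) \<in> (chain_algebra P :: ('a, 'k) mpolynomial set)}"

definition canonical_set :: "'k::field itself \<Rightarrow> 'a::order set \<Rightarrow> ('a \<Rightarrow> nat) set" where
  "canonical_set K P =
     {f \<in> chain_semigroup K P. \<forall>g\<in>chain_semigroup K P.
        \<exists>n::nat. n > 0 \<and> (\<exists>h\<in>chain_semigroup K P. \<forall>x. n * f x = g x + h x)}"

subsection \<open>The bipartite graphs between consecutive ranks\<close>

definition level_graph_verts :: "'a::order set \<Rightarrow> nat \<Rightarrow> 'a set" where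
  "level_graph_verts P i = rank_level P i \<union> rank_level P (i + 1)"

definition level_graph_adj :: "'a::order set \<Rightarrow> nat \<Rightarrow> 'a rel" where
  "level_graph_adj P i =
     {(a, b). (a \<in> rank_level P i \<and> b \<in> rank_level P (i + 1) \<and> covers P b a) \<or>
              (b \<in> rank_level P i \<and> a \<in> rank_level P (i + 1) \<and> covers P a b)}"

text \<open>The vertex sets of connected components are the classes of reachability by paths.\<close>

definition level_graph_components :: "'a::order set \<Rightarrow> nat \<Rightarrow> 'a set set" where
  "level_graph_components P i = level_graph_verts P i // (level_graph_adj P i)\<^sup>*"

definition rank_components :: "'a::order set \<Rightarrow> nat \<Rightarrow> 'a set set" where
  "rank_components P i = {V \<inter> rank_level P i | V. V \<in> level_graph_components P i}"

end

theory Submission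
  imports Defs
begin

text \<open>
  The chain semigroup consists of the sums of indicator functions of maximal chains. A maximal
  chain meets \<open>N(X)\<close> whenever it meets \<open>X\<close>, so members \<open>f\<close> of the semigroup satisfy
  \<open>f(X) \<le> f(N(X))\<close>, with equality on connected components. Conversely these weighted Hall conditions suffice: Hall's theorem
  matches the multiset \<open>f\<close> on each level with the one on the next, and following the matchings
  upwards splits \<open>f\<close> into maximal chains. The set \<open>K\<^sub>P\<close> is the relative interior of the cone cut
  out by these inequalities, which is described by making the non-tautological ones strict: a strict
  gap survives the subtraction of any \<open>g\<close> from \<open>n f\<close> for large \<open>n\<close>, and conversely a chain
  that meets \<open>N(X)\<close> but not \<open>X\<close> (or passes through \<open>x\<close>) forces strictness.
\<close>

section \<open>Hall's marriage theorem\<close>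

text \<open>Induction on the index set in two cases. If every nonempty proper subfamily has a
  surplus, any choice for one index costs the others at most one element each time. Otherwise a
  tight subfamily is matched inside its own union, and the remaining indices are matched outside
  that union.\<close>

lemma hall_marriage:
  assumes "finite I" and "\<And>i. i \<in> I \<Longrightarrow> finite (S i)"
    and "\<And>J. J \<subseteq> I \<Longrightarrow> card J \<le> card (\<Union> (S ` J))"
  shows "\<exists>R. (\<forall>i\<in>I. R i \<in> S i) \<and> inj_on R I"
  using assms
proof (induction I arbitrary: S rule: finite_psubset_induct)
  case (psubset I)
  have fin: "finite (\<Union> (S ` J))" if "J \<subseteq> I" for J
    using that psubset.hyps psubset.prems(1) by (meson finite_UN finite_subset subsetD)
  show ?case
  proof (cases "I = {}")
    case True
    then show ?thesis by simp
  next
    case nonempty: False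
    show ?thesis
    proof (cases "\<exists>J. J \<noteq> {} \<and> J \<subset> I \<and> card J = card (\<Union> (S ` J))")
      case False
      then have strict: "card J < card (\<Union> (S ` J))" if "J \<noteq> {}" "J \<subset> I" for J
        using that psubset.prems(2)[of J] by (metis order_less_le psubset_imp_subset)
      obtain i where i: "i \<in> I" using nonempty by blast
      have "card {i} \<le> card (\<Union> (S ` {i}))" using i by (intro psubset.prems(2)) simp
      then obtain x where x: "x \<in> S i" by fastforce
      define S' where "S' j = S j - {x}" for j
      have "\<exists>R. (\<forall>j\<in>I - {i}. R j \<in> S' j) \<and> inj_on R (I - {i})"
      proof (rule psubset.IH)
        show "I - {i} \<subset> I" using i by blast
        show "finite (S' j)" if "j \<in> I - {i}" for j
          using that psubset.prems(1) by (simp add: S'_def)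
        show "card J \<le> card (\<Union> (S' ` J))" if J: "J \<subseteq> I - {i}" for J
        proof (cases "J = {}")
          case False
          have "card J < card (\<Union> (S ` J))" using strict[OF False] J i by blast
          moreover have "\<Union> (S' ` J) = \<Union> (S ` J) - {x}" by (auto simp: S'_def)
          moreover have "finite (\<Union> (S ` J))" using J by (intro fin) blast
          ultimately show ?thesis by (auto simp: card_Diff_singleton_if)
        qed simp
      qed
      then obtain R where R: "\<forall>j\<in>I - {i}. R j \<in> S' j" "inj_on R (I - {i})" by blast
      have "\<forall>j\<in>I. (R(i := x)) j \<in> S j" using R(1) x by (auto simp: S'_def)
      moreover have "inj_on (R(i := x)) I"
        using R by (auto simp: inj_on_def S'_def)
      ultimately show ?thesis by blast
    next
      case True
      then obtain J where J: "J \<noteq> {}" "J \<subset> I" "card J = card (\<Union> (S ` J))" by blast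
      define U where "U = \<Union> (S ` J)"
      define S' where "S' j = S j - U" for j
      have finU: "finite U" using fin[of J] J by (auto simp: U_def)
      have "\<exists>R. (\<forall>j\<in>J. R j \<in> S j) \<and> inj_on R J"
        using J psubset.prems by (intro psubset.IH) auto
      then obtain R1 where R1: "\<forall>j\<in>J. R1 j \<in> S j" "inj_on R1 J" by blast
      have "\<exists>R. (\<forall>j\<in>I - J. R j \<in> S' j) \<and> inj_on R (I - J)"
      proof (rule psubset.IH)
        show "I - J \<subset> I" using J by blast
        show "finite (S' j)" if "j \<in> I - J" for j
          using that psubset.prems(1) by (simp add: S'_def)
        show "card K \<le> card (\<Union> (S' ` K))" if K: "K \<subseteq> I - J" for K
        proof -
          have fK: "finite K" "finite J" using K J psubset.hyps by (meson finite_Diff finite_subset psubsetE)+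
          \<comment> \<open>Hall's condition is used for \<open>J \<union> K\<close>; as the union
            over \<open>J\<close> has exactly \<open>card J\<close> elements, at least
            \<open>card K\<close> elements remain for \<open>K\<close>.\<close>
          have "card J + card K = card (J \<union> K)"
            using K fK by (subst card_Un_disjoint) auto
          also have "\<dots> \<le> card (\<Union> (S ` (J \<union> K)))"
            using K J by (intro psubset.prems(2)) blast
          also have "\<Union> (S ` (J \<union> K)) = U \<union> \<Union> (S' ` K)" by (auto simp: S'_def U_def)
          also have "card \<dots> \<le> card U + card (\<Union> (S' ` K))" by (rule card_Un_le)
          finally show ?thesis using J by (simp add: U_def)
        qed
      qed
      then obtain R2 where R2: "\<forall>j\<in>I - J. R2 j \<in> S' j" "inj_on R2 (I - J)" by blast
      define R where "R j = (if j \<in> J then R1 j else R2 j)" for j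
      have "\<forall>j\<in>I. R j \<in> S j" using R1 R2 by (auto simp: R_def S'_def)
      moreover have "inj_on R I"
      proof -
        have "R1 a \<noteq> R2 b" if "a \<in> J" "b \<in> I - J" for a b
          using that R1(1) R2(1) by (fastforce simp: S'_def U_def)
        then show ?thesis using R1(2) R2(2) unfolding inj_on_def R_def by (metis DiffI)
      qed
      ultimately show ?thesis by blast
    qed
  qed
qed

section \<open>The rank function of a pure poset\<close>

lemma chain_extends_to_maximal_chain:
  assumes "finite P" "pred_on.chain P (<) D"
  obtains C where "maximal_chain P C" "D \<subseteq> C"
proof -
  let ?M = "{C. pred_on.chain P (<) C \<and> D \<subseteq> C}"
  have "finite ?M"
    using assms(1) by (rule finite_subset[rotated, OF finite_Pow_iff[THEN iffD2]])
      (auto simp: pred_on.chain_def)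
  moreover have "D \<in> ?M" using assms(2) by simp
  ultimately have "\<exists>C\<in>?M. D \<subseteq> C \<and> (\<forall>B\<in>?M. C \<subseteq> B \<longrightarrow> C = B)"
    by (rule finite_has_maximal2)
  then obtain C where C: "C \<in> ?M" "D \<subseteq> C" and max: "\<forall>B\<in>?M. C \<subseteq> B \<longrightarrow> C = B"
    by (elim bexE conjE)
  have "maximal_chain P C"
    unfolding maximal_chain_def pred_on.maxchain_def
  proof (intro conjI notI)
    show "pred_on.chain P (<) C" using C by simp
    assume "\<exists>S. pred_on.chain P (<) S \<and> C \<subset> S"
    then obtain S where S: "pred_on.chain P (<) S" "C \<subset> S" by (elim exE conjE)
    then have "S \<in> ?M" using C(2) by auto
    then have "C = S" using max S(2) by (simp add: less_imp_le)
    then show False using S(2) by simp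
  qed
  then show ?thesis using C(2) by (rule that)
qed

lemma ex_lower_cover:
  assumes "finite P" "y \<in> P" "x \<in> P" "x < y"
  obtains z where "covers P y z"
proof -
  have "finite {z \<in> P. z < y}" "x \<in> {z \<in> P. z < y}" using assms by auto
  then obtain z where z: "z \<in> {z \<in> P. z < y}"
      and m: "\<And>b. b \<in> {z \<in> P. z < y} \<Longrightarrow> z \<le> b \<Longrightarrow> z = b"
    using finite_has_maximal2[of "{z \<in> P. z < y}" x] by blast
  then have "covers P y z" using assms unfolding covers_def
    by (metis (mono_tags, lifting) mem_Collect_eq order_less_le)
  then show ?thesis by (rule that)
qed

text \<open>Both functions are 0 at minimal elements and elsewhere are fixed by their value at a
  lower cover, which has fewer elements below it. Uniqueness is what makes the \<open>THE\<close> in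
  \<open>rank_fun\<close> meaningful.\<close>

lemma rank_function_unique:
  assumes "finite P" "is_rank_function P \<rho>" "is_rank_function P \<sigma>"
  shows "\<rho> = \<sigma>"
proof
  fix x
  show "\<rho> x = \<sigma> x"
  proof (cases "x \<in> P")
    case False
    then show ?thesis using assms unfolding is_rank_function_def by auto
  next
    case True
    then show ?thesis
    proof (induction "card {z \<in> P. z < x}" arbitrary: x rule: less_induct)
      case less
      show ?case
      proof (cases "\<exists>z\<in>P. z < x")
        case False
        then show ?thesis using assms less.prems unfolding is_rank_function_def by auto
      next
        case True
        then obtain z where z: "covers P x z"
          using ex_lower_cover assms(1) less.prems by metis
        then have "z \<in> P" "z < x" by (auto simp: covers_def)
        have "\<rho> z = \<sigma> z"
        proof (rule less.hyps)
          show "card {w \<in> P. w < z} < card {w \<in> P. w < x}"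
            using assms(1) \<open>z \<in> P\<close> \<open>z < x\<close> by (intro psubset_card_mono) auto
        qed fact
        moreover have "\<rho> x = \<rho> z + 1" "\<sigma> x = \<sigma> z + 1"
          using z assms unfolding is_rank_function_def by blast+
        ultimately show ?thesis by simp
      qed
    qed
  qed
qed

section \<open>Longest chains through an element, and rank in a pure poset\<close>

locale pure_poset =
  fixes P :: "'a::order set" and r :: nat
  assumes finite_P: "finite P" and pure: "pure_of_rank P r"
begin

lemma card_maximal_chain: "maximal_chain P C \<Longrightarrow> card C = r + 1"
  using pure unfolding pure_of_rank_def by blast

definition chains_below :: "'a \<Rightarrow> 'a set set" where
  "chains_below x = {C. pred_on.chain P (<) C \<and> x \<in> C \<and> (\<forall>z\<in>C. z \<le> x)}"

definition chains_above :: "'a \<Rightarrow> 'a set set" where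
  "chains_above x = {C. pred_on.chain P (<) C \<and> x \<in> C \<and> (\<forall>z\<in>C. x \<le> z)}"

text \<open>Elements are counted rather than steps, so the rank of \<open>x\<close> in
  \<open>P\<close> will be \<open>height x - 1\<close>.\<close>

definition height :: "'a \<Rightarrow> nat" where "height x = Max (card ` chains_below x)"

definition coheight :: "'a \<Rightarrow> nat" where "coheight x = Max (card ` chains_above x)"

lemma finite_chains: "finite (chains_below x)" "finite (chains_above x)"
  using finite_P by (auto simp: chains_below_def chains_above_def pred_on.chain_def
      intro: finite_subset[of _ "Pow P"])

lemma singleton_chain:
  "x \<in> P \<Longrightarrow> {x} \<in> chains_below x" "x \<in> P \<Longrightarrow> {x} \<in> chains_above x"
  by (auto simp: chains_below_def chains_above_def pred_on.chain_def)

lemma card_le_height: "C \<in> chains_below x \<Longrightarrow> card C \<le> height x"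
  using finite_chains by (simp add: height_def)

lemma card_le_coheight: "C \<in> chains_above x \<Longrightarrow> card C \<le> coheight x"
  using finite_chains by (simp add: coheight_def)

lemma height_attained:
  assumes "x \<in> P" obtains C where "C \<in> chains_below x" "card C = height x"
proof -
  have "height x \<in> card ` chains_below x"
    unfolding height_def using finite_chains singleton_chain[OF assms] by (intro Max_in) auto
  then show ?thesis using that by auto
qed

lemma coheight_attained:
  assumes "x \<in> P" obtains C where "C \<in> chains_above x" "card C = coheight x"
proof -
  have "coheight x \<in> card ` chains_above x"
    unfolding coheight_def using finite_chains singleton_chain[OF assms] by (intro Max_in) auto
  then show ?thesis using that by auto
qed

text \<open>Otherwise inserting \<open>z\<close> would give a longer chain below \<open>x\<close>.
  This yields one half of the maximality of glued chains.\<close>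

lemma longest_below_absorbs:
  assumes "C \<in> chains_below x" "card C = height x" "z \<in> P" "z \<le> x"
    "\<And>c. c \<in> C \<Longrightarrow> c \<le> z \<or> z \<le> c"
  shows "z \<in> C"
proof (rule ccontr)
  assume "z \<notin> C"
  have "insert z C \<in> chains_below x"
    using assms unfolding chains_below_def pred_on.chain_def by (auto simp: order.order_iff_strict)
  moreover have "finite C" using assms(1) finite_P
    by (auto simp: chains_below_def pred_on.chain_def intro: finite_subset)
  ultimately show False using card_le_height[of "insert z C" x] \<open>z \<notin> C\<close> assms(2) by simp
qed

lemma longest_above_absorbs:
  assumes "C \<in> chains_above x" "card C = coheight x" "z \<in> P" "x \<le> z"
    "\<And>c. c \<in> C \<Longrightarrow> c \<le> z \<or> z \<le> c"
  shows "z \<in> C"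
proof (rule ccontr)
  assume "z \<notin> C"
  have "insert z C \<in> chains_above x"
    using assms unfolding chains_above_def pred_on.chain_def by (auto simp: order.order_iff_strict)
  moreover have "finite C" using assms(1) finite_P
    by (auto simp: chains_above_def pred_on.chain_def intro: finite_subset)
  ultimately show False using card_le_coheight[of "insert z C" x] \<open>z \<notin> C\<close> assms(2) by simp
qed

text \<open>Gluing a longest chain below \<open>x\<close> to a longest chain above \<open>y\<close> gives a maximal chain
  whenever nothing lies strictly between; the two cases give the rank function.\<close>

lemma glued_chain_maximal:
  assumes "x \<in> P" "y \<in> P" "x \<le> y" "\<not> (\<exists>z\<in>P. x < z \<and> z < y)"
    and C: "C \<in> chains_below x" "card C = height x"
    and D: "D \<in> chains_above y" "card D = coheight y"
  shows "maximal_chain P (C \<union> D)"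
proof -
  have "x \<in> C" "y \<in> D" using C D by (auto simp: chains_below_def chains_above_def)
  have below: "\<forall>c\<in>C. c \<le> x" and above: "\<forall>d\<in>D. y \<le> d"
    and chs: "pred_on.chain P (<) C" "pred_on.chain P (<) D"
    using C D by (auto simp: chains_below_def chains_above_def)
  have "c \<le> d" if "c \<in> C" "d \<in> D" for c d
    using below above assms(3) that by (meson order.trans)
  then have ch: "pred_on.chain P (<) (C \<union> D)"
    using chs unfolding pred_on.chain_def by (auto simp: order.order_iff_strict)
  have "S \<subseteq> C \<union> D" if S: "pred_on.chain P (<) S" "C \<union> D \<subseteq> S" for S
  proof
    fix z assume z: "z \<in> S"
    then have "z \<in> P" and cmp: "\<And>w. w \<in> S \<Longrightarrow> w \<le> z \<or> z \<le> w"
      using S unfolding pred_on.chain_def by (auto simp: order.order_iff_strict)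
    \<comment> \<open>\<open>z\<close> is comparable with both \<open>x\<close> and \<open>y\<close>
      and cannot lie strictly between them, so it falls on a side where a longest chain absorbs
      it.\<close>
    consider "z \<le> x" | "y \<le> z"
      using cmp[of x] cmp[of y] assms(4) \<open>z \<in> P\<close> \<open>x \<in> C\<close> \<open>y \<in> D\<close> S(2)
      by (auto simp: order.order_iff_strict)
    then show "z \<in> C \<union> D"
    proof cases
      case 1
      then show ?thesis using longest_below_absorbs[OF C \<open>z \<in> P\<close>] cmp S(2) by blast
    next
      case 2
      then show ?thesis using longest_above_absorbs[OF D \<open>z \<in> P\<close>] cmp S(2) by blast
    qed
  qed
  then show ?thesis using ch unfolding maximal_chain_def pred_on.maxchain_def by blast
qed

text \<open>Gluing at \<open>x\<close> itself gives a maximal chain of \<open>r + 1\<close> elements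
  in which \<open>x\<close> has been counted twice.\<close>

lemma height_plus_coheight:
  assumes "x \<in> P" shows "height x + coheight x = r + 2"
proof -
  obtain C where C: "C \<in> chains_below x" "card C = height x" using height_attained assms by blast
  obtain D where D: "D \<in> chains_above x" "card D = coheight x" using coheight_attained assms by blast
  have "C \<inter> D = {x}" using C D by (fastforce simp: chains_below_def chains_above_def)
  moreover have "finite C" "finite D" using C D finite_P
    by (auto simp: chains_below_def chains_above_def pred_on.chain_def intro: finite_subset)
  moreover have "maximal_chain P (C \<union> D)" using assms C D by (intro glued_chain_maximal) auto
  ultimately show ?thesis
    using card_Un_Int[of C D] card_maximal_chain[of "C \<union> D"] C D by simp
qed

text \<open>Here the two glued chains are disjoint, so nothing is counted twice. Compared with
  \<open>height_plus_coheight\<close> at \<open>y\<close>, this shows that height grows by exactly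
  one along a cover.\<close>

lemma height_plus_coheight_cover:
  assumes "covers P y x" shows "height x + coheight y = r + 1"
proof -
  have xy: "x \<in> P" "y \<in> P" "x < y" "\<not> (\<exists>z\<in>P. x < z \<and> z < y)" using assms by (auto simp: covers_def)
  obtain C where C: "C \<in> chains_below x" "card C = height x" using height_attained xy by blast
  obtain D where D: "D \<in> chains_above y" "card D = coheight y" using coheight_attained xy by blast
  have "C \<inter> D = {}"
    using C D xy by (force simp: chains_below_def chains_above_def)
  moreover have "finite C" "finite D" using C D finite_P
    by (auto simp: chains_below_def chains_above_def pred_on.chain_def intro: finite_subset)
  moreover have "maximal_chain P (C \<union> D)" using xy C D by (intro glued_chain_maximal) auto
  ultimately show ?thesis
    using card_Un_Int[of C D] card_maximal_chain[of "C \<union> D"] C D by simp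
qed

lemma height_pos: "x \<in> P \<Longrightarrow> 1 \<le> height x"
  using card_le_height[OF singleton_chain(1)] by simp

lemma coheight_pos: "x \<in> P \<Longrightarrow> 1 \<le> coheight x"
  using card_le_coheight[OF singleton_chain(2)] by simp

lemma is_rank_function_height:
  "is_rank_function P (\<lambda>x. if x \<in> P then height x - 1 else 0)"
  unfolding is_rank_function_def
proof (intro conjI allI impI ballI)
  fix m assume m: "m \<in> P" "\<not> (\<exists>x\<in>P. x < m)"
  obtain C where C: "C \<in> chains_below m" "card C = height m" using height_attained m by blast
  then have "c = m" if "c \<in> C" for c
    using m that by (auto simp: chains_below_def pred_on.chain_def order.order_iff_strict)
  moreover have "m \<in> C" using C by (simp add: chains_below_def)
  ultimately have "C = {m}" by blast
  then show "(if m \<in> P then height m - 1 else 0) = 0" using C by simp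
next
  fix x y assume c: "covers P y x"
  then have "x \<in> P" "y \<in> P" by (auto simp: covers_def)
  then show "(if y \<in> P then height y - 1 else 0) = (if x \<in> P then height x - 1 else 0) + 1"
    using height_plus_coheight_cover[OF c] height_plus_coheight[of y] height_pos[of x] by simp
qed simp

lemma rank_fun_eq: "rank_fun P = (\<lambda>x. if x \<in> P then height x - 1 else 0)"
  unfolding rank_fun_def
  using is_rank_function_height rank_function_unique[OF finite_P] by (intro the_equality) blast+

lemma rank_cover: "covers P y x \<Longrightarrow> rank_fun P y = rank_fun P x + 1"
  using is_rank_function_height unfolding rank_fun_eq is_rank_function_def by blast

lemma rank_le: "rank_fun P x \<le> r"
  using height_plus_coheight[of x] coheight_pos[of x] by (auto simp: rank_fun_eq)

text \<open>Appending \<open>y\<close> to a longest chain below \<open>x\<close> gives a longer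
  chain below \<open>y\<close>.\<close>

lemma rank_strict_mono:
  assumes "x \<in> P" "y \<in> P" "x < y" shows "rank_fun P x < rank_fun P y"
proof -
  obtain C where C: "C \<in> chains_below x" "card C = height x" using height_attained assms by blast
  have below: "c < y" if "c \<in> C" for c using that C assms by (auto simp: chains_below_def)
  then have "insert y C \<in> chains_below y"
    using C assms unfolding chains_below_def pred_on.chain_def by (auto intro: order.strict_implies_order)
  moreover have "y \<notin> C" "finite C" using below C finite_P
    by (auto simp: chains_below_def pred_on.chain_def intro: finite_subset)
  ultimately have "height x < height y" using C card_le_height[of "insert y C" y] by simp
  then show ?thesis using assms height_pos[of x] by (simp add: rank_fun_eq)
qed

lemma ex_lower_cover_rank:
  assumes "y \<in> rank_level P (i + 1)"
  obtains x where "x \<in> rank_level P i" "covers P y x"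
proof -
  have y: "y \<in> P" "rank_fun P y = i + 1" using assms by (auto simp: rank_level_def)
  have "\<exists>x\<in>P. x < y"
  proof (rule ccontr)
    assume "\<not> ?thesis"
    then have "rank_fun P y = 0"
      using y is_rank_function_height unfolding rank_fun_eq is_rank_function_def by blast
    with y show False by simp
  qed
  then obtain x where "covers P y x" using ex_lower_cover finite_P y(1) by metis
  moreover from this have "x \<in> rank_level P i"
    using rank_cover y by (fastforce simp: rank_level_def covers_def)
  ultimately show ?thesis using that by blast
qed

text \<open>Strict monotonicity makes the rank injective on a chain, and \<open>r + 1\<close>
  distinct values in \<open>{..r}\<close> exhaust it.\<close>

lemma maximal_chain_rank_bij:
  assumes "maximal_chain P C" shows "bij_betw (rank_fun P) C {..r}"
proof -
  have ch: "pred_on.chain P (<) C" using assms by (simp add: maximal_chain_def pred_on.maxchain_def)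
  have "x = y" if "x \<in> C" "y \<in> C" "rank_fun P x = rank_fun P y" for x y
    using ch that rank_strict_mono[of x y] rank_strict_mono[of y x]
    by (auto simp: pred_on.chain_def)
  then have "inj_on (rank_fun P) C" by (rule inj_onI)
  moreover have "rank_fun P ` C = {..r}"
    using rank_le card_maximal_chain[OF assms] calculation
    by (intro card_subset_eq) (auto simp: card_image)
  ultimately show ?thesis by (simp add: bij_betw_def)
qed

lemma maximal_chain_consecutive_covers:
  assumes C: "maximal_chain P C" and xy: "x \<in> C" "y \<in> C" "rank_fun P y = rank_fun P x + 1"
  shows "covers P y x"
proof -
  have ch: "pred_on.chain P (<) C" using C by (simp add: maximal_chain_def pred_on.maxchain_def)
  have P: "x \<in> P" "y \<in> P" using ch xy by (auto simp: pred_on.chain_def)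
  have "x < y \<or> x = y \<or> y < x" using ch xy by (auto simp: pred_on.chain_def)
  then have "x < y" using xy P rank_strict_mono[of y x] by auto
  moreover have False if "z \<in> P" "x < z" "z < y" for z
    using rank_strict_mono[of x z] rank_strict_mono[of z y] that P xy by simp
  ultimately show ?thesis using P by (auto simp: covers_def)
qed

text \<open>The sequence is strictly increasing, so its image has \<open>r + 1\<close> elements. A
  maximal chain containing the image has equally many and therefore coincides with it.\<close>

lemma saturated_sequence_maximal_chain:
  assumes "e 0 \<in> rank_level P 0" "\<And>i. i < r \<Longrightarrow> covers P (e (i + 1)) (e i)"
  shows "maximal_chain P (e ` {..r})"
    and "\<And>i. i \<le> r \<Longrightarrow> e i \<in> rank_level P i"
proof -
  show lev: "e i \<in> rank_level P i" if "i \<le> r" for i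
    using that
  proof (induction i)
    case (Suc i)
    then show ?case using assms(2)[of i] rank_cover by (force simp: rank_level_def covers_def)
  qed (use assms in simp)
  have less: "e i < e j" if "i < j" "j \<le> r" for i j
    using that
  proof (induction j)
    case (Suc j)
    then have "e j < e (Suc j)" using assms(2)[of j] by (simp add: covers_def)
    then show ?case using Suc by (cases "i = j") auto
  qed simp
  have "pred_on.chain P (<) (e ` {..r})"
    unfolding pred_on.chain_def
  proof (intro conjI ballI)
    show "e ` {..r} \<subseteq> P" using lev by (auto simp: rank_level_def)
    fix x y assume "x \<in> e ` {..r}" "y \<in> e ` {..r}"
    then obtain i j where "i \<le> r" "j \<le> r" "x = e i" "y = e j" by auto
    then show "(<)\<^sup>=\<^sup>= x y \<or> (<)\<^sup>=\<^sup>= y x" using less[of i j] less[of j i] by (cases i j rule: linorder_cases) auto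
  qed
  then obtain C where C: "maximal_chain P C" "e ` {..r} \<subseteq> C"
    using chain_extends_to_maximal_chain finite_P by blast
  have "i = j" if "i \<le> r" "j \<le> r" "e i = e j" for i j
    using that less[of i j] less[of j i] by (cases i j rule: linorder_cases) auto
  then have "inj_on e {..r}" by (auto intro: inj_onI)
  then have "card (e ` {..r}) = card C" using card_maximal_chain[OF C(1)] by (simp add: card_image)
  moreover have "finite C" using card_maximal_chain[OF C(1)] by (intro card_ge_0_finite) simp
  ultimately have "e ` {..r} = C" using C(2) by (intro card_subset_eq)
  then show "maximal_chain P (e ` {..r})" using C(1) by simp
qed

end

section \<open>The chain semigroup as a monoid\<close>

text \<open>The field-free form of the chain semigroup: its members are the exponent vectors of
  products of the generators \<open>x_C\<close>.\<close>

inductive_set chain_monoid :: "'a::order set \<Rightarrow> ('a \<Rightarrow> nat) set" for P where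
  zero: "(\<lambda>_. 0) \<in> chain_monoid P"
| add_chain: "f \<in> chain_monoid P \<Longrightarrow> maximal_chain P C \<Longrightarrow>
    (\<lambda>x. f x + of_bool (x \<in> C)) \<in> chain_monoid P"

lemma chain_monoid_indicator:
  "maximal_chain P C \<Longrightarrow> (\<lambda>x. of_bool (x \<in> C)) \<in> chain_monoid P"
  using chain_monoid.add_chain[OF chain_monoid.zero] by simp

lemma chain_monoid_add:
  assumes "f \<in> chain_monoid P" "g \<in> chain_monoid P"
  shows "(\<lambda>x. f x + g x) \<in> chain_monoid P"
  using assms(2)
proof induction
  case zero
  then show ?case using assms(1) by simp
next
  case (add_chain g C)
  then show ?case using chain_monoid.add_chain[of "\<lambda>x. f x + g x" P C] by (simp add: add.assoc)
qed

lemma chain_monoid_sum: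
  fixes D :: "nat \<Rightarrow> 'a::order set"
  assumes "\<And>j. j < m \<Longrightarrow> maximal_chain P (D j)"
  shows "(\<lambda>x. \<Sum>j<m. of_bool (x \<in> D j)) \<in> chain_monoid P"
  using assms
proof (induction m)
  case 0
  then show ?case using chain_monoid.zero by simp
next
  case (Suc m)
  then show ?case
    using chain_monoid.add_chain[of "\<lambda>x. \<Sum>j<m. of_bool (x \<in> D j)" P "D m"] by simp
qed

lemma maximal_chain_subset: "maximal_chain P C \<Longrightarrow> C \<subseteq> P"
  by (simp add: maximal_chain_def pred_on.maxchain_def pred_on.chain_def)

lemma chain_monoid_outside:
  assumes "f \<in> chain_monoid P" "x \<notin> P" shows "f x = 0"
  using assms by induction (use maximal_chain_subset in auto)

section \<open>Exponent vectors of the chain algebra\<close>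

lemma var_poly_power:
  "var_poly x ^ n = (Poly_Mapping.single (Poly_Mapping.single x n) 1 :: ('a, 'k::field) mpolynomial)"
  by (induction n) (simp_all add: var_poly_def mult_single flip: single_add)

lemma prod_var_poly_power:
  assumes "finite A"
  shows "(\<Prod>x\<in>A. var_poly x ^ f x) =
    (Poly_Mapping.single (\<Sum>x\<in>A. Poly_Mapping.single x (f x)) 1 :: ('a, 'k::field) mpolynomial)"
  using assms by induction (simp_all add: var_poly_power mult_single)

lemma lookup_sum_single:
  assumes "finite A"
  shows "Poly_Mapping.lookup (\<Sum>x\<in>A. Poly_Mapping.single x (f x :: nat)) =
    (\<lambda>y. if y \<in> A then f y else 0)"
  using assms by induction (auto simp: lookup_add lookup_single when_def fun_eq_iff)

text \<open>The polynomials all of whose exponent vectors lie in the monoid form a subalgebra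
  containing the generators, hence contain the hull.\<close>

lemma chain_algebra_keys:
  assumes "finite P" "p \<in> (chain_algebra P :: ('a::order, 'k::field) mpolynomial set)"
    "m \<in> Poly_Mapping.keys p"
  shows "Poly_Mapping.lookup m \<in> chain_monoid P"
proof -
  let ?A = "{p :: ('a, 'k) mpolynomial. \<forall>m\<in>Poly_Mapping.keys p. Poly_Mapping.lookup m \<in> chain_monoid P}"
  have "chain_algebra P \<subseteq> ?A"
    unfolding chain_algebra_def
  proof (rule hull_minimal)
    show "is_subalgebra ?A"
      unfolding is_subalgebra_def
    proof (intro conjI allI ballI)
      fix c :: 'k
      show "const_poly c \<in> ?A"
        using chain_monoid.zero[of P] by (auto simp: const_poly_def zero_poly_mapping.rep_eq)
    next
      fix p q assume "p \<in> ?A" "q \<in> ?A"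
      then show "p + q \<in> ?A" using keys_add[of p q] by blast
    next
      fix p q assume pq: "p \<in> ?A" "q \<in> ?A"
      have "Poly_Mapping.lookup m \<in> chain_monoid P" if m: "m \<in> Poly_Mapping.keys (p * q)" for m
      proof -
        obtain a b where ab: "m = a + b" "a \<in> Poly_Mapping.keys p" "b \<in> Poly_Mapping.keys q"
          using m keys_mult[of p q] by blast
        have "Poly_Mapping.lookup m = (\<lambda>x. Poly_Mapping.lookup a x + Poly_Mapping.lookup b x)"
          using ab by (simp add: plus_poly_mapping.rep_eq)
        then show ?thesis using chain_monoid_add[of "Poly_Mapping.lookup a" P "Poly_Mapping.lookup b"] ab pq by simp
      qed
      then show "p * q \<in> ?A" by blast
    qed
    show "{\<Prod>x\<in>C. var_poly x |C. maximal_chain P C} \<subseteq> ?A"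
    proof clarify
      fix C m
      assume C: "maximal_chain P C"
        and m: "m \<in> Poly_Mapping.keys (\<Prod>x\<in>C. var_poly x :: ('a, 'k) mpolynomial)"
      have fin: "finite C" using maximal_chain_subset[OF C] assms(1) by (rule finite_subset)
      have "m = (\<Sum>x\<in>C. Poly_Mapping.single x 1)"
        using m prod_var_poly_power[OF fin, of "\<lambda>_. 1", where 'k = 'k] by simp
      then have "Poly_Mapping.lookup m = (\<lambda>x. of_bool (x \<in> C))"
        using lookup_sum_single[OF fin, of "\<lambda>_. 1"] by (auto simp: fun_eq_iff)
      then show "Poly_Mapping.lookup m \<in> chain_monoid P" using chain_monoid_indicator[OF C] by simp
    qed
  qed
  then show ?thesis using assms by blast
qed

lemma chain_algebra_monomial:
  assumes "finite P" "f \<in> chain_monoid P"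
  shows "(\<Prod>x\<in>P. var_poly x ^ f x) \<in> (chain_algebra P :: ('a::order, 'k::field) mpolynomial set)"
proof -
  \<comment> \<open>Being a subalgebra is preserved by arbitrary intersections, so the hull is
    itself a subalgebra.\<close>
  have sub: "is_subalgebra (chain_algebra P :: ('a, 'k) mpolynomial set)"
    unfolding chain_algebra_def by (rule hull_in) (auto simp: is_subalgebra_def)
  show ?thesis
    using assms(2)
  proof induction
    case zero
    have "const_poly 1 \<in> (chain_algebra P :: ('a, 'k) mpolynomial set)"
      using sub by (simp add: is_subalgebra_def)
    then show ?case by (simp add: const_poly_def)
  next
    case (add_chain f C)
    have "(\<Prod>x\<in>C. var_poly x) \<in> (chain_algebra P :: ('a, 'k) mpolynomial set)"
      unfolding chain_algebra_def using add_chain.hyps by (intro hull_inc) blast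
    moreover have "(\<Prod>x\<in>P. var_poly x ^ of_bool (x \<in> C)) =
        (\<Prod>x\<in>C. var_poly x :: ('a, 'k) mpolynomial)"
      using assms(1) maximal_chain_subset[OF add_chain.hyps(2)]
      by (intro prod.mono_neutral_cong_right) auto
    ultimately show ?case
      using add_chain.IH sub by (simp add: is_subalgebra_def power_add prod.distrib)
  qed
qed

lemma chain_semigroup_eq:
  fixes P :: "'a::order set"
  assumes "finite P" shows "chain_semigroup TYPE('k::field) P = chain_monoid P"
proof (intro equalityI subsetI)
  fix f :: "'a \<Rightarrow> nat" assume "f \<in> chain_monoid P"
  then show "f \<in> chain_semigroup TYPE('k) P"
    using chain_algebra_monomial[OF assms] chain_monoid_outside
    unfolding chain_semigroup_def by blast
next
  fix f :: "'a \<Rightarrow> nat" assume f: "f \<in> chain_semigroup TYPE('k) P"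
  let ?m = "\<Sum>x\<in>P. Poly_Mapping.single x (f x)"
  have "(Poly_Mapping.single ?m 1 :: ('a, 'k) mpolynomial) \<in> chain_algebra P"
    using f prod_var_poly_power[OF assms, of f, where 'k = 'k] by (simp add: chain_semigroup_def)
  \<comment> \<open>The coefficient 1 is nonzero, so \<open>?m\<close> really is a key of this
    monomial.\<close>
  then have "Poly_Mapping.lookup ?m \<in> chain_monoid P"
    by (rule chain_algebra_keys[OF assms]) simp
  moreover have "Poly_Mapping.lookup ?m = f"
    using f lookup_sum_single[OF assms, of f] by (auto simp: chain_semigroup_def fun_eq_iff)
  ultimately show "f \<in> chain_monoid P" by simp
qed

section \<open>Weighted Hall conditions\<close>

context pure_poset
begin

lemma finite_rank_level: "finite (rank_level P i)"
  using finite_P by (simp add: rank_level_def)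

lemma cover_nbhd_subset: "cover_nbhd P i X \<subseteq> rank_level P (i + 1)"
  by (auto simp: cover_nbhd_def)

lemma cover_nbhd_lower_level:
  "b \<in> cover_nbhd P i X \<Longrightarrow> covers P b a \<Longrightarrow> a \<in> rank_level P i"
  using rank_cover[of b a] by (auto simp: cover_nbhd_def rank_level_def covers_def)

lemma maximal_chain_meets_level:
  assumes "maximal_chain P C" "i \<le> r"
  obtains c where "c \<in> C" "c \<in> rank_level P i"
proof -
  have "i \<in> rank_fun P ` C"
    using maximal_chain_rank_bij[OF assms(1)] assms(2) by (simp add: bij_betw_def)
  then show ?thesis
    using that maximal_chain_subset[OF assms(1)] by (auto simp: rank_level_def)
qed

text \<open>A maximal chain has only one element on each level, so \<open>c\<close> alone can
  contribute.\<close>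

lemma sum_chain_indicator:
  assumes C: "maximal_chain P C" and c: "c \<in> C" "c \<in> rank_level P i" and X: "X \<subseteq> rank_level P i"
  shows "(\<Sum>x\<in>X. of_bool (x \<in> C)) = (of_bool (c \<in> X) :: nat)"
proof -
  have "x \<in> C \<longleftrightarrow> x = c" if "x \<in> X" for x
    using maximal_chain_rank_bij[OF C] c X that
    by (auto simp: bij_betw_def rank_level_def dest: inj_onD)
  then have "(\<Sum>x\<in>X. of_bool (x \<in> C)) = (\<Sum>x\<in>X. if x = c then 1 else 0 :: nat)"
    by (intro sum.cong) auto
  also have "\<dots> = of_bool (c \<in> X)"
    using finite_subset[OF X finite_rank_level] by simp
  finally show ?thesis .
qed

text \<open>The elements of a maximal chain on two consecutive levels form a cover, so a chain that
  adds 1 on the left also adds 1 on the right.\<close>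

lemma chain_monoid_sum_le:
  assumes "f \<in> chain_monoid P" "i < r" "X \<subseteq> rank_level P i"
  shows "sum f X \<le> sum f (cover_nbhd P i X)"
  using assms(1)
proof induction
  case zero
  then show ?case by simp
next
  case (add_chain f C)
  obtain c where c: "c \<in> C" "c \<in> rank_level P i"
    using maximal_chain_meets_level[OF add_chain.hyps(2), of i] assms(2) by auto
  obtain d where d: "d \<in> C" "d \<in> rank_level P (i + 1)"
    using maximal_chain_meets_level[OF add_chain.hyps(2), of "i + 1"] assms(2) by auto
  have "covers P d c"
    using maximal_chain_consecutive_covers[OF add_chain.hyps(2)] c d by (simp add: rank_level_def)
  then have "c \<in> X \<Longrightarrow> d \<in> cover_nbhd P i X" using d by (auto simp: cover_nbhd_def)
  then show ?case
    using add_chain.IH sum_chain_indicator[OF add_chain.hyps(2) c assms(3)]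
      sum_chain_indicator[OF add_chain.hyps(2) d cover_nbhd_subset[of i X]]
    by (auto simp: sum.distrib)
qed

text \<open>The hypothesis \<open>closed\<close> says that \<open>X\<close> is a union of rank
  components. A maximal chain then meets \<open>X\<close> exactly when it meets the
  neighbourhood.\<close>

lemma chain_monoid_sum_eq:
  assumes "f \<in> chain_monoid P" "i < r" "X \<subseteq> rank_level P i"
    and closed: "\<And>a b. b \<in> cover_nbhd P i X \<Longrightarrow> covers P b a \<Longrightarrow> a \<in> X"
  shows "sum f X = sum f (cover_nbhd P i X)"
  using assms(1)
proof induction
  case zero
  then show ?case by simp
next
  case (add_chain f C)
  obtain c where c: "c \<in> C" "c \<in> rank_level P i"
    using maximal_chain_meets_level[OF add_chain.hyps(2), of i] assms(2) by auto
  obtain d where d: "d \<in> C" "d \<in> rank_level P (i + 1)"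
    using maximal_chain_meets_level[OF add_chain.hyps(2), of "i + 1"] assms(2) by auto
  have "covers P d c"
    using maximal_chain_consecutive_covers[OF add_chain.hyps(2)] c d by (simp add: rank_level_def)
  then have "c \<in> X \<longleftrightarrow> d \<in> cover_nbhd P i X" using d closed by (auto simp: cover_nbhd_def)
  then show ?case
    using add_chain.IH sum_chain_indicator[OF add_chain.hyps(2) c assms(3)]
      sum_chain_indicator[OF add_chain.hyps(2) d cover_nbhd_subset[of i X]]
    by (simp add: sum.distrib)
qed

end

section \<open>Splitting a weight function into maximal chains\<close>

text \<open>The pairs \<open>(x, k)\<close> with \<open>k < f x\<close> act as \<open>f x\<close>
  tokens for \<open>x\<close>, so an enumeration of all tokens names \<open>x\<close> that many
  times.\<close>

lemma card_bij_betw_Sigma_fiber: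
  assumes "bij_betw h J (SIGMA x:A. {..<f x :: nat})" "x \<in> A"
  shows "card {j \<in> J. fst (h j) = x} = f x"
proof -
  have "h ` {j \<in> J. fst (h j) = x} = {x} \<times> {..<f x}"
  proof (intro equalityI subsetI)
    fix t assume "t \<in> h ` {j \<in> J. fst (h j) = x}"
    then obtain j where "j \<in> J" "t = h j" "fst t = x" by blast
    then show "t \<in> {x} \<times> {..<f x}" using bij_betwE[OF assms(1)] by (cases t) fastforce
  next
    fix t assume t: "t \<in> {x} \<times> {..<f x}"
    then have "t \<in> h ` J" using assms by (auto simp: bij_betw_def)
    then obtain j where "j \<in> J" "t = h j" by blast
    then show "t \<in> h ` {j \<in> J. fst (h j) = x}" using t by auto
  qed
  moreover have "inj_on h {j \<in> J. fst (h j) = x}"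
    using assms(1) by (auto simp: bij_betw_def intro: inj_on_subset)
  ultimately have "card {j \<in> J. fst (h j) = x} = card ({x} \<times> {..<f x})"
    by (metis card_image)
  then show ?thesis by (simp add: card_cartesian_product)
qed

context pure_poset
begin

text \<open>The multiset \<open>f\<close> on one level, encoded by positions \<open>j < m\<close>
  because position \<open>j\<close> is to follow the same chain through all levels.\<close>

definition lists_level :: "('a \<Rightarrow> nat) \<Rightarrow> nat \<Rightarrow> nat \<Rightarrow> (nat \<Rightarrow> 'a) \<Rightarrow> bool" where
  "lists_level f m i e \<longleftrightarrow> (\<forall>j<m. e j \<in> rank_level P i) \<and>
     (\<forall>x\<in>rank_level P i. card {j \<in> {..<m}. e j = x} = f x)"

lemma lists_level_tokens:
  assumes "bij_betw h {..<m} (SIGMA x:rank_level P i. {..<f x})"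
  shows "lists_level f m i (fst \<circ> h)"
proof -
  have "fst (h j) \<in> rank_level P i" if "j < m" for j
  proof -
    have "h j \<in> (SIGMA x:rank_level P i. {..<f x})" using bij_betwE[OF assms] that by blast
    then show ?thesis by (elim SigmaE) simp
  qed
  then show ?thesis using card_bij_betw_Sigma_fiber[OF assms] by (simp add: lists_level_def)
qed

lemma ex_lists_level:
  assumes "sum f (rank_level P i) = m"
  obtains e where "lists_level f m i e"
proof -
  let ?T = "SIGMA x:rank_level P i. {..<f x}"
  have "finite ?T" "card ?T = m" using finite_rank_level assms by auto
  then obtain h where h: "bij_betw h {..<m} ?T"
    by (metis ex_bij_betw_nat_finite atLeast0LessThan)
  then show ?thesis using that lists_level_tokens by blast
qed

text \<open>Splitting each element \<open>y\<close> of the next level into \<open>f y\<close> tokens turns the weighted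
  inequalities into Hall's condition.\<close>

lemma lists_level_step:
  assumes i: "i < r" and e: "lists_level f m i e"
    and total: "sum f (rank_level P (i + 1)) = m"
    and ineq: "\<And>X. X \<subseteq> rank_level P i \<Longrightarrow> sum f X \<le> sum f (cover_nbhd P i X)"
  obtains e' where "lists_level f m (i + 1) e'" "\<And>j. j < m \<Longrightarrow> covers P (e' j) (e j)"
proof -
  let ?T = "SIGMA y:rank_level P (i + 1). {..<f y}"
  have T: "finite ?T" "card ?T = m" using finite_rank_level total by auto
  \<comment> \<open>Position \<open>j\<close> may move up to any token of an element covering
    \<open>e j\<close>.\<close>
  define S where "S j = {t \<in> ?T. covers P (fst t) (e j)}" for j
  have "\<exists>R. (\<forall>j\<in>{..<m}. R j \<in> S j) \<and> inj_on R {..<m}"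
  proof (rule hall_marriage)
    show "finite (S j)" for j using T by (simp add: S_def)
    show "card J \<le> card (\<Union> (S ` J))" if J: "J \<subseteq> {..<m}" for J
    proof -
      have eJ: "e ` J \<subseteq> rank_level P i" using J e by (auto simp: lists_level_def)
      have finJ: "finite J" using J finite_subset by blast
      have "card J \<le> card (\<Union>x\<in>e ` J. {j \<in> {..<m}. e j = x})"
        using J finJ by (intro card_mono) auto
      also have "\<dots> \<le> (\<Sum>x\<in>e ` J. card {j \<in> {..<m}. e j = x})"
        using finJ by (intro card_UN_le) simp
      also have "\<dots> = sum f (e ` J)"
        using e eJ by (intro sum.cong) (auto simp: lists_level_def)
      also have "\<dots> \<le> sum f (cover_nbhd P i (e ` J))" by (rule ineq[OF eJ])
      also have "\<dots> = card (SIGMA y:cover_nbhd P i (e ` J). {..<f y})"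
        using finite_subset[OF cover_nbhd_subset finite_rank_level] by simp
      also have "(SIGMA y:cover_nbhd P i (e ` J). {..<f y}) = \<Union> (S ` J)"
        by (auto simp: S_def cover_nbhd_def)
      finally show ?thesis .
    qed
  qed simp
  then obtain R where R: "\<forall>j\<in>{..<m}. R j \<in> S j" "inj_on R {..<m}" by blast
  have "R ` {..<m} \<subseteq> ?T" using R(1) unfolding S_def by blast
  \<comment> \<open>There are as many tokens as positions, so the injective matching is perfect and
    every element is used with its full multiplicity.\<close>
  then have "R ` {..<m} = ?T"
    using R(2) T by (intro card_subset_eq) (simp_all add: card_image)
  then have bij: "bij_betw R {..<m} ?T" using R by (simp add: bij_betw_def)
  have "lists_level f m (i + 1) (fst \<circ> R)"
    using bij by (rule lists_level_tokens)
  moreover have "covers P ((fst \<circ> R) j) (e j)" if "j < m" for j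
    using R that by (simp add: S_def)
  ultimately show ?thesis by (rule that)
qed

text \<open>By \<open>eq\<close> every level has the same total \<open>m\<close>, so each level
  matches perfectly with the next. Following position \<open>j\<close> upwards through the matchings
  traces the \<open>j\<close>-th of \<open>m\<close> maximal chains.\<close>

lemma chain_monoidI:
  assumes outside: "\<And>x. x \<notin> P \<Longrightarrow> f x = 0"
    and ineq: "\<And>i X. i < r \<Longrightarrow> X \<subseteq> rank_level P i \<Longrightarrow> sum f X \<le> sum f (cover_nbhd P i X)"
    and eq: "\<And>i. i < r \<Longrightarrow> sum f (rank_level P i) = sum f (rank_level P (i + 1))"
  shows "f \<in> chain_monoid P"
proof -
  define m where "m = sum f (rank_level P 0)"
  have tot: "sum f (rank_level P i) = m" if "i \<le> r" for i
    using that
  proof (induction i)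
    case (Suc i)
    then show ?case using eq[of i] by simp
  qed (simp add: m_def)
  \<comment> \<open>The choice principle runs over all naturals; the guards leave levels beyond
    \<open>r\<close> unconstrained.\<close>
  let ?good = "\<lambda>i e. i \<le> r \<longrightarrow> lists_level f m i e"
  let ?step = "\<lambda>i e e'. i < r \<longrightarrow> (\<forall>j<m. covers P (e' j) (e j))"
  have "\<exists>E. \<forall>i. ?good i (E i) \<and> ?step i (E i) (E (Suc i))"
  proof (rule dependent_nat_choice)
    show "\<exists>e. ?good 0 e" using ex_lists_level[OF tot[of 0]] by blast
    fix e i assume g: "?good i e"
    show "\<exists>e'. ?good (Suc i) e' \<and> ?step i e e'"
    proof (cases "i < r")
      case True
      then have le: "lists_level f m i e" and "sum f (rank_level P (i + 1)) = m"
        using g tot[of "i + 1"] by simp_all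
      from lists_level_step[OF True le this(2) ineq[OF True]] show ?thesis
        by (metis Suc_eq_plus1)
    qed simp
  qed
  then obtain E where E: "\<And>i. i \<le> r \<Longrightarrow> lists_level f m i (E i)"
      and cov: "\<And>i j. i < r \<Longrightarrow> j < m \<Longrightarrow> covers P (E (Suc i) j) (E i j)" by blast
  define D where "D j = (\<lambda>i. E i j) ` {..r}" for j
  have seq: "maximal_chain P (D j)" "\<And>i. i \<le> r \<Longrightarrow> E i j \<in> rank_level P i" if "j < m" for j
    using saturated_sequence_maximal_chain[of "\<lambda>i. E i j"] that cov E[of 0]
    by (auto simp: D_def lists_level_def)
  have "f = (\<lambda>x. \<Sum>j<m. of_bool (x \<in> D j))"
  proof
    fix x
    show "f x = (\<Sum>j<m. of_bool (x \<in> D j))"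
    proof (cases "x \<in> P")
      case False
      then have "x \<notin> D j" if "j < m" for j
        using maximal_chain_subset[OF seq(1)[OF that]] by blast
      then show ?thesis using outside[OF False] by simp
    next
      case True
      define i where "i = rank_fun P x"
      have i: "i \<le> r" "x \<in> rank_level P i" using True rank_le by (auto simp: i_def rank_level_def)
      \<comment> \<open>The \<open>j\<close>-th chain has one element per level, so it can pass
        through \<open>x\<close> only at the rank of \<open>x\<close>.\<close>
      have "x \<in> D j \<longleftrightarrow> E i j = x" if "j < m" for j
      proof
        show "x \<in> D j \<Longrightarrow> E i j = x"
          using seq(2)[OF that] i by (auto simp: D_def rank_level_def)
        show "E i j = x \<Longrightarrow> x \<in> D j" using i(1) by (auto simp: D_def)
      qed
      then have "(\<Sum>j<m. of_bool (x \<in> D j)) = (\<Sum>j<m. of_bool (E i j = x) :: nat)"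
        by (intro sum.cong) auto
      also have "\<dots> = card {j \<in> {..<m}. E i j = x}"
        by (simp add: of_bool_def sum.If_cases Int_def)
      also have "\<dots> = f x" using E[OF i(1)] i(2) by (simp add: lists_level_def)
      finally show ?thesis by simp
    qed
  qed
  then show ?thesis using chain_monoid_sum[of m P D] seq(1) by metis
qed

section \<open>Connected components\<close>

lemma sym_level_graph_adj: "sym (level_graph_adj P i)"
  by (auto simp: sym_def level_graph_adj_def)

lemma rank_component_subset: "Q \<in> rank_components P i \<Longrightarrow> Q \<subseteq> rank_level P i"
  by (auto simp: rank_components_def)

text \<open>Two edges through \<open>b\<close> lead from an element of \<open>Q\<close> to
  \<open>a\<close>.\<close>

lemma rank_component_closed:
  assumes "Q \<in> rank_components P i" "b \<in> cover_nbhd P i Q" "covers P b a"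
  shows "a \<in> Q"
proof -
  obtain v where Q: "Q = (level_graph_adj P i)\<^sup>* `` {v} \<inter> rank_level P i"
    using assms(1) by (auto simp: rank_components_def level_graph_components_def quotient_def)
  obtain q where q: "q \<in> Q" "covers P b q" "b \<in> rank_level P (i + 1)"
    using assms(2) by (auto simp: cover_nbhd_def)
  have a: "a \<in> rank_level P i" using cover_nbhd_lower_level assms by blast
  have "(q, b) \<in> level_graph_adj P i" "(b, a) \<in> level_graph_adj P i"
    using q a assms(3) Q by (auto simp: level_graph_adj_def)
  moreover have "(v, q) \<in> (level_graph_adj P i)\<^sup>*" using q Q by blast
  ultimately have "(v, a) \<in> (level_graph_adj P i)\<^sup>*" by (meson rtrancl.rtrancl_into_rtrancl)
  then show ?thesis using a Q by blast
qed

lemma ex_rank_component: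
  assumes "x \<in> rank_level P i" obtains Q where "Q \<in> rank_components P i" "x \<in> Q"
proof -
  have "(level_graph_adj P i)\<^sup>* `` {x} \<in> level_graph_components P i"
    using assms by (auto simp: level_graph_components_def level_graph_verts_def intro: quotientI)
  then have "(level_graph_adj P i)\<^sup>* `` {x} \<inter> rank_level P i \<in> rank_components P i"
    by (auto simp: rank_components_def)
  then show ?thesis using that assms by blast
qed

text \<open>If no such cover existed, \<open>X\<close> together with its neighbourhood would be
  closed under adjacency and would contain the whole component.\<close>

lemma rank_component_connected:
  assumes Q: "Q \<in> rank_components P i" and X: "X \<noteq> {}" "X \<subset> Q"
  obtains a b where "b \<in> cover_nbhd P i X" "covers P b a" "a \<notin> X"
proof (rule ccontr)
  assume "\<not> thesis"
  then have closed: "\<And>a b. b \<in> cover_nbhd P i X \<Longrightarrow> covers P b a \<Longrightarrow> a \<in> X" using that by blast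
  obtain v where v: "Q = (level_graph_adj P i)\<^sup>* `` {v} \<inter> rank_level P i"
    using Q by (auto simp: rank_components_def level_graph_components_def quotient_def)
  obtain x where x: "x \<in> X" using X by blast
  have disj: "rank_level P i \<inter> rank_level P (i + 1) = {}" by (auto simp: rank_level_def)
  have XQ: "X \<subseteq> rank_level P i" using X v by blast
  have "q \<in> X" if "q \<in> Q" for q
  proof -
    \<comment> \<open>Adjacency is symmetric, so the path from the representative \<open>v\<close>
      to \<open>x\<close> can be reversed.\<close>
    have "(x, v) \<in> (level_graph_adj P i)\<^sup>*"
      using x X v sym_rtrancl[OF sym_level_graph_adj] by (meson Image_singleton_iff IntE psubsetD symD)
    moreover have "(v, q) \<in> (level_graph_adj P i)\<^sup>*" using that v by blast
    ultimately have "(x, q) \<in> (level_graph_adj P i)\<^sup>*" by (rule rtrancl_trans)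
    then have "q \<in> X \<union> cover_nbhd P i X"
    proof induction
      case base
      then show ?case using x by blast
    next
      case (step y z)
      from step.IH consider "y \<in> X" | "y \<in> cover_nbhd P i X" by blast
      then show ?case
      proof cases
        case 1
        then have "z \<in> rank_level P (i + 1)" "covers P z y"
          using step.hyps(2) XQ disj by (auto simp: level_graph_adj_def)
        then show ?thesis using 1 by (auto simp: cover_nbhd_def)
      next
        case 2
        then have "covers P y z"
          using step.hyps(2) cover_nbhd_subset[of i X] disj by (auto simp: level_graph_adj_def)
        then show ?thesis using closed 2 by blast
      qed
    qed
    moreover have "q \<notin> cover_nbhd P i X" using that v cover_nbhd_subset disj by blast
    ultimately show ?thesis by blast
  qed
  then show False using X by blast
qed

text \<open>The inequalities may be checked inside one component at a time, because a component and
  its complement in the level have disjoint neighbourhoods.\<close>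

lemma sum_le_cover_nbhd_by_components:
  assumes comp: "\<And>Q Y. Q \<in> rank_components P i \<Longrightarrow> Y \<noteq> {} \<Longrightarrow> Y \<subseteq> Q \<Longrightarrow>
      sum h Y \<le> sum h (cover_nbhd P i Y)"
    and X: "X \<subseteq> rank_level P i"
  shows "sum (h :: 'a \<Rightarrow> nat) X \<le> sum h (cover_nbhd P i X)"
  using finite_subset[OF X finite_rank_level] X
proof (induction X rule: finite_psubset_induct)
  case (psubset X)
  show ?case
  proof (cases "X = {}")
    case False
    then obtain x where x: "x \<in> X" by blast
    then obtain Q where Q: "Q \<in> rank_components P i" "x \<in> Q"
      using ex_rank_component psubset.prems by blast
    have "sum h (X \<inter> Q) \<le> sum h (cover_nbhd P i (X \<inter> Q))"
      using x Q by (intro comp[OF Q(1)]) auto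
    moreover have "sum h (X - Q) \<le> sum h (cover_nbhd P i (X - Q))"
      using x Q psubset.prems by (intro psubset.IH) auto
    moreover have "sum h X = sum h (X \<inter> Q) + sum h (X - Q)"
      using psubset.hyps by (rule sum.Int_Diff)
    moreover have "sum h (cover_nbhd P i X) =
        sum h (cover_nbhd P i (X \<inter> Q)) + sum h (cover_nbhd P i (X - Q))"
    proof -
      have "cover_nbhd P i X = cover_nbhd P i (X \<inter> Q) \<union> cover_nbhd P i (X - Q)"
        by (auto simp: cover_nbhd_def)
      moreover have "cover_nbhd P i (X \<inter> Q) \<inter> cover_nbhd P i (X - Q) = {}"
      proof -
        \<comment> \<open>A common neighbour would lie in the neighbourhood of \<open>Q\<close>
          while covering an element outside \<open>Q\<close>, which
          \<open>rank_component_closed\<close> forbids.\<close>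
        have False if b: "b \<in> cover_nbhd P i (X \<inter> Q)" "b \<in> cover_nbhd P i (X - Q)" for b
        proof -
          have "b \<in> cover_nbhd P i Q" using b(1) by (auto simp: cover_nbhd_def)
          moreover obtain a where "covers P b a" "a \<notin> Q" using b(2) by (auto simp: cover_nbhd_def)
          ultimately show False using rank_component_closed[OF Q(1)] by blast
        qed
        then show ?thesis by blast
      qed
      ultimately show ?thesis
        using finite_subset[OF cover_nbhd_subset finite_rank_level] by (simp add: sum.union_disjoint)
    qed
    ultimately show ?thesis by simp
  qed simp
qed

section \<open>The canonical set\<close>

lemma canonicalD:
  assumes "f \<in> canonical_set TYPE('k::field) P" "g \<in> chain_monoid P"
  obtains n h where "n > 0" "h \<in> chain_monoid P" "\<And>x. n * f x = g x + h x"
proof -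
  have "\<forall>g\<in>chain_monoid P. \<exists>n>0. \<exists>h\<in>chain_monoid P. \<forall>x. n * f x = g x + h x"
    using assms(1) by (simp add: canonical_set_def chain_semigroup_eq[OF finite_P])
  then have "\<exists>n>0. \<exists>h\<in>chain_monoid P. \<forall>x. n * f x = g x + h x"
    using assms(2) by (rule bspec)
  then show ?thesis using that by (elim exE conjE bexE) simp
qed

text \<open>The defining property is tested on the indicator of a maximal chain through
  \<open>x\<close>, which makes a multiple of \<open>f x\<close> at least 1.\<close>

lemma canonical_pos:
  assumes f: "f \<in> canonical_set TYPE('k::field) P" and x: "x \<in> P"
  shows "0 < f x"
proof -
  have "pred_on.chain P (<) {x}" using x by (simp add: pred_on.chain_def)
  then obtain C where C: "maximal_chain P C" "{x} \<subseteq> C"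
    using chain_extends_to_maximal_chain finite_P by blast
  obtain n h where "n > 0" "h \<in> chain_monoid P" "\<And>y. n * f y = of_bool (y \<in> C) + h y"
    by (rule canonicalD[OF f chain_monoid_indicator[OF C(1)]]) blast
  then have "n * f x = 1 + h x" using C(2) by simp
  then show ?thesis by (cases "f x") auto
qed

text \<open>The test element is the indicator of a maximal chain through a cover from
  \<open>a\<close> outside \<open>X\<close> to \<open>b\<close> in the neighbourhood of
  \<open>X\<close>. It adds 1 to the larger side only, while the remainder \<open>h\<close> obeys
  the weak inequality.\<close>

lemma canonical_strict:
  assumes f: "f \<in> canonical_set TYPE('k::field) P" and i: "i < r"
    and Q: "Q \<in> rank_components P i" and X: "X \<noteq> {}" "X \<subset> Q"
  shows "sum f X < sum f (cover_nbhd P i X)"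
proof -
  obtain a b where ab: "b \<in> cover_nbhd P i X" "covers P b a" "a \<notin> X"
    using rank_component_connected[OF Q X] by blast
  have Xl: "X \<subseteq> rank_level P i" using X rank_component_subset[OF Q] by blast
  have lev: "a \<in> rank_level P i" "b \<in> rank_level P (i + 1)"
    using ab cover_nbhd_lower_level cover_nbhd_subset by blast+
  have "pred_on.chain P (<) {a, b}" using ab(2) by (auto simp: pred_on.chain_def covers_def)
  then obtain C where C: "maximal_chain P C" "{a, b} \<subseteq> C"
    using chain_extends_to_maximal_chain finite_P by blast
  obtain n h where n: "n > 0" and h: "h \<in> chain_monoid P"
      and eq: "\<And>y. n * f y = of_bool (y \<in> C) + h y"
    by (rule canonicalD[OF f chain_monoid_indicator[OF C(1)]]) blast
  have sums: "n * sum f Y = (\<Sum>y\<in>Y. of_bool (y \<in> C)) + sum h Y" for Y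
    unfolding sum_distrib_left by (simp only: eq sum.distrib)
  have "a \<in> C" "b \<in> C" using C(2) by auto
  have "n * sum f X = sum h X"
    unfolding sums sum_chain_indicator[OF C(1) \<open>a \<in> C\<close> lev(1) Xl] using ab(3) by simp
  also have "\<dots> \<le> sum h (cover_nbhd P i X)" by (rule chain_monoid_sum_le[OF h i Xl])
  also have "\<dots> < n * sum f (cover_nbhd P i X)"
    unfolding sums sum_chain_indicator[OF C(1) \<open>b \<in> C\<close> lev(2) cover_nbhd_subset]
    using ab(1) by simp
  finally show ?thesis by simp
qed

text \<open>For given \<open>g\<close>, the difference \<open>n * f - g\<close> is shown to satisfy
  the criterion \<open>chain_monoidI\<close> once \<open>n\<close> is large.\<close>

lemma canonicalI:
  assumes f: "f \<in> chain_monoid P"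
    and strict: "\<And>i Q X. i < r \<Longrightarrow> Q \<in> rank_components P i \<Longrightarrow> X \<noteq> {} \<Longrightarrow> X \<subset> Q \<Longrightarrow>
      sum f X < sum f (cover_nbhd P i X)"
    and pos: "\<And>x. x \<in> P \<Longrightarrow> 0 < f x"
  shows "f \<in> canonical_set TYPE('k::field) P"
proof -
  have "\<exists>n>0. \<exists>h\<in>chain_monoid P. \<forall>x. n * f x = g x + h x" if g: "g \<in> chain_monoid P" for g
  proof -
    \<comment> \<open>Larger than the sum of \<open>g\<close> over any subset of \<open>P\<close>,
      and positive even when \<open>g\<close> vanishes.\<close>
    define n where "n = 1 + sum g P"
    define h where "h x = n * f x - g x" for x
    \<comment> \<open>This keeps the truncated subtraction in \<open>h\<close> from losing anything;
      positivity of \<open>f\<close> on \<open>P\<close> enters here.\<close>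
    have gle: "g x \<le> n * f x" for x
    proof (cases "x \<in> P")
      case True
      have "g x \<le> sum g P" using True finite_P by (simp add: member_le_sum)
      also have "\<dots> \<le> n * f x" using pos[OF True] by (cases "f x") (auto simp: n_def)
      finally show ?thesis .
    qed (simp add: chain_monoid_outside[OF g])
    then have split: "n * f x = g x + h x" for x by (simp add: h_def)
    then have sums: "n * sum f Y = sum g Y + sum h Y" for Y
      by (simp add: sum_distrib_left sum.distrib)
    \<comment> \<open>On closed sets \<open>f\<close> and \<open>g\<close> are both balanced, hence
      so is their difference.\<close>
    have closed_eq: "sum h Y = sum h (cover_nbhd P i Y)"
      if "i < r" "Y \<subseteq> rank_level P i"
        "\<And>a b. b \<in> cover_nbhd P i Y \<Longrightarrow> covers P b a \<Longrightarrow> a \<in> Y" for i Y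
      using sums[of Y] sums[of "cover_nbhd P i Y"] chain_monoid_sum_eq[OF f that]
        chain_monoid_sum_eq[OF g that] by simp
    have "h \<in> chain_monoid P"
    proof (rule chain_monoidI)
      show "h x = 0" if "x \<notin> P" for x
        using that chain_monoid_outside[OF f] by (simp add: h_def)
    next
      fix i X assume i: "i < r" and X: "X \<subseteq> rank_level P i"
      show "sum h X \<le> sum h (cover_nbhd P i X)"
      proof (rule sum_le_cover_nbhd_by_components[OF _ X])
        fix Q Y assume Q: "Q \<in> rank_components P i" and Y: "Y \<noteq> {}" "Y \<subseteq> Q"
        show "sum h Y \<le> sum h (cover_nbhd P i Y)"
        proof (cases "Y = Q")
          case True
          then show ?thesis
            using closed_eq[OF i rank_component_subset[OF Q]] rank_component_closed[OF Q] by simp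
        next
          case False
          let ?N = "cover_nbhd P i Y"
          \<comment> \<open>The integer gap of at least 1 grows to at least \<open>n\<close>, which
            exceeds what subtracting \<open>g\<close> can remove from the neighbourhood.\<close>
          have "sum f Y + 1 \<le> sum f ?N" using strict[OF i Q Y(1)] Y(2) False by force
          then have "n * (sum f Y + 1) \<le> n * sum f ?N" by (rule mult_le_mono2)
          moreover have "sum g ?N \<le> sum g P"
            using finite_P by (intro sum_mono2) (auto simp: cover_nbhd_def rank_level_def)
          ultimately show ?thesis using sums[of Y] sums[of ?N] by (simp add: n_def)
        qed
      qed
    next
      fix i assume i: "i < r"
      \<comment> \<open>Every element of positive rank covers something, so the whole level, a
        closed set, has the whole next level as neighbourhood.\<close>
      have "cover_nbhd P i (rank_level P i) = rank_level P (i + 1)"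
        using ex_lower_cover_rank by (auto simp: cover_nbhd_def) (metis Suc_eq_plus1)
      moreover have "sum h (rank_level P i) = sum h (cover_nbhd P i (rank_level P i))"
        by (rule closed_eq[OF i order.refl]) (rule cover_nbhd_lower_level)
      ultimately show "sum h (rank_level P i) = sum h (rank_level P (i + 1))" by simp
    qed
    moreover have "n > 0" by (simp add: n_def)
    ultimately show ?thesis using split by blast
  qed
  then show ?thesis
    using f by (simp add: canonical_set_def chain_semigroup_eq[OF finite_P])
qed

end

theorem theorem5p5:
  fixes P :: "'a::order set" and r :: nat and f :: "'a \<Rightarrow> nat"
  assumes "finite P"
    and "pure_of_rank P r"
    and "f \<in> chain_semigroup TYPE('k::field) P"
  shows "f \<in> canonical_set TYPE('k) P \<longleftrightarrow>
    (\<forall>i<r. \<forall>Q\<in>rank_components P i. \<forall>X. X \<noteq> {} \<and> X \<subset> Q \<longrightarrow>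
        sum f X < sum f (cover_nbhd P i X)) \<and>
    (\<forall>x\<in>P. 0 < f x)"
proof -
  interpret pure_poset P r using assms by unfold_locales
  have f: "f \<in> chain_monoid P" using assms(3) chain_semigroup_eq[OF assms(1)] by blast
  show ?thesis
  proof
    assume "f \<in> canonical_set TYPE('k) P"
    from canonical_strict[OF this] canonical_pos[OF this]
    show "(\<forall>i<r. \<forall>Q\<in>rank_components P i. \<forall>X. X \<noteq> {} \<and> X \<subset> Q \<longrightarrow>
        sum f X < sum f (cover_nbhd P i X)) \<and> (\<forall>x\<in>P. 0 < f x)" by simp
  next
    assume "(\<forall>i<r. \<forall>Q\<in>rank_components P i. \<forall>X. X \<noteq> {} \<and> X \<subset> Q \<longrightarrow>
        sum f X < sum f (cover_nbhd P i X)) \<and> (\<forall>x\<in>P. 0 < f x)"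
    then show "f \<in> canonical_set TYPE('k) P" by (intro canonicalI[OF f]) simp_all
  qed
qed

end
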